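(* Let $\alpha$ be a continuous action of a countable sofic group $G$ on a compact metrizable space $X$ and let $\Sigma$ be a sofic approximation sequence of $G$. If $f,g$ are real valued continuous functions on $X$, $s\in G$ and $c\in\mathbb{R}$, then the following are true. (i) $P_\Sigma(0,X,G)=h_\Sigma(X,G)$. (ii) $P_\Sigma(f+c,X,G)=P_\Sigma(f,X,G)+c$. (iii) $P_\Sigma(f+g,X,G)\le P_\Sigma(f,X,G)+P_\Sigma(g,X,G)$. (iv) $f\le g$ implies $P_\Sigma(f,X,G)\le P_\Sigma(g,X,G)$. In particular, $h_\Sigma(X,G)+\min f\le P_\Sigma(f,X,G)\le h_\Sigma(X,G)+\max f$. (v) $P_\Sigma(\cdot,X,G)$ is either finite valued or constantly $\pm\infty$. (vi) If $P_\Sigma(\cdot,X,G)\ne\pm\infty$, then $|P_\Sigma(f,X,G)-P_\Sigma(g,X,G)|\le\|f-g\|_\infty$, where $\|\cdot\|_\infty$ is the supremum norm on the space of real valued continuous functions on $X$. (vii) If $P_\Sigma(\cdot,X,G)\ne\pm\infty$, then $P_\Sigma(\cdot,X,G)$ is convex. (viii) $P_\Sigma(f+g\circ\alpha_s-g,X,G)=P_\Sigma(f,X,G)$. (ix) $P_\Sigma(cf,X,G)\le c\cdot P_\Sigma(f,X,G)$ if $c\ge1$, and $P_\Sigma(cf,X,G)\ge c\cdot P_\Sigma(f,X,G)$ if $c\le1$. (x) $|P_\Sigma(f,X,G)|\le P_\Sigma(|f|,X,G)$.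
   Context: **Sofic groups.** For $d\in\mathbb{N}$ write $[d]=\{1,\dots,d\}$ and $\mathrm{Sym}(d)$ for the permutation group of $[d]$. A sofic approximation sequence for a countable group $G$ is a sequence $\Sigma=\{\sigma_i:G\to\mathrm{Sym}(d_i)\}_{i\in\mathbb{N}}$ of maps (not necessarily homomorphisms; $d_i\in\mathbb{N}$; $\sigma_{i,s}=\sigma_i(s)$) such that (1) $\lim_{i}\frac{1}{d_i}|\{a\in[d_i]:\sigma_{i,s}\sigma_{i,t}(a)=\sigma_{i,st}(a)\}|=1$ for all $s,t\in G$; (2) $\lim_i\frac1{d_i}|\{a\in[d_i]:\sigma_{i,s}(a)\ne\sigma_{i,t}(a)\}|=1$ for all distinct $s,t\in G$; (3) $\lim_i d_i=\infty$. $G$ is sofic if such a sequence exists. The action is written $\alpha_s(x)=sx$. **Sofic topological pressure and entropy.** Let $\rho$ be a compatible metric on $X$. For maps $\varphi,\psi:[d]\to X$ put $\rho_2(\varphi,\psi)=\big(\frac1d\sum_{a=1}^d\rho(\varphi(a),\psi(a))^2\big)^{1/2}$ and $\rho_\infty(\varphi,\psi)=\max_{1\le a\le d}\rho(\varphi(a),\psi(a))$. For a nonempty finite $F\subset G$, $\delta>0$ and a map $\sigma:G\to\mathrm{Sym}(d)$, written $s\mapsto\sigma_s$, let $\mathrm{Map}(\rho,F,\delta,\sigma)$ be the set of all $\varphi:[d]\to X$ with $\max_{s\in F}\rho_2(\alpha_s\circ\varphi,\varphi\circ\sigma_s)<\delta$. A subset $A$ of a (pseudo)metric space $(Y,d_Y)$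 is $(d_Y,\varepsilon)$-separated if $d_Y(x,y)\ge\varepsilon$ for all distinct $x,y\in A$; $N_\varepsilon(Y,d_Y)$ is the maximal cardinality of a finite $(d_Y,\varepsilon)$-separated subset of $Y$. For $\varepsilon>0$ let $$M^\varepsilon_{\Sigma,\infty}(f,X,G,\rho,F,\delta,\sigma)=\sup_{\mathcal{E}}\sum_{\varphi\in\mathcal{E}}\exp\Big(\sum_{a=1}^d f(\varphi(a))\Big),$$ with $\mathcal{E}$ running over the $(\rho_\infty,\varepsilon)$-separated subsets of $\mathrm{Map}(\rho,F,\delta,\sigma)$. Define $$P_{\Sigma,\infty}(f,X,G,\rho)=\sup_{\varepsilon>0}\ \inf_{F}\ \inf_{\delta>0}\ \limsup_{i\to\infty}\frac1{d_i}\log M^\varepsilon_{\Sigma,\infty}(f,X,G,\rho,F,\delta,\sigma_i)\in[-\infty,+\infty],$$ $F$ running over nonempty finite subsets of $G$, with $\log 0=-\infty$ (so the limsup is $-\infty$ if $\mathrm{Map}(\rho,F,\delta,\sigma_i)=\emptyset$ for all large $i$). This value does not depend on the compatible metric $\rho$ and is denoted $P_\Sigma(f,X,G)$. The sofic topological entropy is $$h_\Sigma(X,G)=\sup_{\varepsilon>0}\ \inf_{F}\ \inf_{\delta>0}\ \limsup_{i\to\infty}\frac1{d_i}\log N_\varepsilon(\mathrm{Map}(\rho,F,\delta,\sigma_i),\rho_\infty).$$ **Conventions.** $P_\Sigma(\cdot,X,G)$ is viewed as a map from the real valued continuous functions on $X$ to $\mathbb{R}\cup\{\pm\infty\}$;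 "constantly $\pm\infty$" means constantly $+\infty$ or constantly $-\infty$, and "$P_\Sigma(\cdot,X,G)\ne\pm\infty$" means that this map is neither constantly $+\infty$ nor constantly $-\infty$.
   Formalization: Part (x), and part (ix) for c ≤ 0, are proved assuming the pressure is not constantly −∞; when it is constantly −∞ (possible, e.g. the free group acting on its boundary), (x) and (ix) for c < 0 fail, and (ix) for c = 0 involves 0·(−∞). *)

theory Defs
  imports "HOL-Analysis.Analysis" "HOL-Algebra.Group_Action"
begin

text \<open>
  The index set \<open>[d]\<close> is \<open>{1..d}\<close>, and a permutation of it is a function on \<open>nat\<close> that
  permutes \<open>{1..d}\<close> (identity elsewhere). Permutations are prescribed only for group elements
  in \<open>carrier G\<close>.
\<close>

definition sofic_approximation ::
    "('g, 'r) monoid_scheme \<Rightarrow> (nat \<Rightarrow> nat) \<Rightarrow> (nat \<Rightarrow> 'g \<Rightarrow> nat \<Rightarrow> nat) \<Rightarrow> bool" where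
  "sofic_approximation G d \<sigma> \<longleftrightarrow>
     (\<forall>i. \<forall>s\<in>carrier G. \<sigma> i s permutes {1..d i}) \<and>
     (\<forall>s\<in>carrier G. \<forall>t\<in>carrier G.
        (\<lambda>i. 1 / real (d i) * real (card {a\<in>{1..d i}. \<sigma> i s (\<sigma> i t a) = \<sigma> i (s \<otimes>\<^bsub>G\<^esub> t) a}))
          \<longlonglongrightarrow> 1) \<and>
     (\<forall>s\<in>carrier G. \<forall>t\<in>carrier G. s \<noteq> t \<longrightarrow>
        (\<lambda>i. 1 / real (d i) * real (card {a\<in>{1..d i}. \<sigma> i s a \<noteq> \<sigma> i t a})) \<longlonglongrightarrow> 1) \<and>
     filterlim d at_top sequentially"

definition sofic_group :: "('g, 'r) monoid_scheme \<Rightarrow> bool" where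
  "sofic_group G \<longleftrightarrow> group G \<and> countable (carrier G) \<and> (\<exists>d \<sigma>. sofic_approximation G d \<sigma>)"

text \<open>
  \<open>group_action\<close> takes each \<open>\<alpha> s\<close> as a bijection in the extensional function space on
  \<open>topspace X\<close>; its values elsewhere carry no information.
\<close>

definition continuous_group_action ::
    "('g, 'r) monoid_scheme \<Rightarrow> 'x topology \<Rightarrow> ('g \<Rightarrow> 'x \<Rightarrow> 'x) \<Rightarrow> bool" where
  "continuous_group_action G X \<alpha> \<longleftrightarrow>
     group_action G (topspace X) \<alpha> \<and> (\<forall>s\<in>carrier G. continuous_map X X (\<alpha> s))"

definition compatible_metric :: "'x topology \<Rightarrow> ('x \<Rightarrow> 'x \<Rightarrow> real) \<Rightarrow> bool" where
  "compatible_metric X \<rho> \<longleftrightarrow>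
     Metric_space (topspace X) \<rho> \<and> Metric_space.mtopology (topspace X) \<rho> = X"

definition rho_2 ::
    "('x \<Rightarrow> 'x \<Rightarrow> real) \<Rightarrow> nat \<Rightarrow> (nat \<Rightarrow> 'x) \<Rightarrow> (nat \<Rightarrow> 'x) \<Rightarrow> real" where
  "rho_2 \<rho> d \<phi> \<psi> = sqrt (1 / real d * (\<Sum>a=1..d. (\<rho> (\<phi> a) (\<psi> a))\<^sup>2))"

definition rho_inf ::
    "('x \<Rightarrow> 'x \<Rightarrow> real) \<Rightarrow> nat \<Rightarrow> (nat \<Rightarrow> 'x) \<Rightarrow> (nat \<Rightarrow> 'x) \<Rightarrow> real" where
  "rho_inf \<rho> d \<phi> \<psi> = (MAX a\<in>{1..d}. \<rho> (\<phi> a) (\<psi> a))"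

text \<open>
  Maps \<open>[d] \<rightarrow> X\<close> are taken in the extensional function space, so that they are determined by
  their values on \<open>{1..d}\<close>; \<open>\<sigma>\<close> is a single map from \<open>G\<close> to the permutations of \<open>{1..d}\<close>.
\<close>

definition sofic_Map ::
    "'x topology \<Rightarrow> ('g \<Rightarrow> 'x \<Rightarrow> 'x) \<Rightarrow> ('x \<Rightarrow> 'x \<Rightarrow> real) \<Rightarrow> 'g set \<Rightarrow> real \<Rightarrow> nat
      \<Rightarrow> ('g \<Rightarrow> nat \<Rightarrow> nat) \<Rightarrow> (nat \<Rightarrow> 'x) set" where
  "sofic_Map X \<alpha> \<rho> F \<delta> d \<sigma> =
     {\<phi> \<in> {1..d} \<rightarrow>\<^sub>E topspace X. (MAX s\<in>F. rho_2 \<rho> d (\<alpha> s \<circ> \<phi>) (\<phi> \<circ> \<sigma> s)) < \<delta>}"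

definition separated :: "('y \<Rightarrow> 'y \<Rightarrow> real) \<Rightarrow> real \<Rightarrow> 'y set \<Rightarrow> bool" where
  "separated D \<epsilon> A \<longleftrightarrow> (\<forall>x\<in>A. \<forall>y\<in>A. x \<noteq> y \<longrightarrow> D x y \<ge> \<epsilon>)"

definition separation_number :: "real \<Rightarrow> 'y set \<Rightarrow> ('y \<Rightarrow> 'y \<Rightarrow> real) \<Rightarrow> ennreal" where
  "separation_number \<epsilon> Y D = (SUP A\<in>{A. finite A \<and> A \<subseteq> Y \<and> separated D \<epsilon> A}. of_nat (card A))"

text \<open>
  The unordered sum in \<open>[0, \<infinity>]\<close> gives the expected value for every separated set
  \<open>E\<close>, finite or not.
\<close>

definition pressure_sum ::
    "real \<Rightarrow> ('x \<Rightarrow> real) \<Rightarrow> 'x topology \<Rightarrow> ('g \<Rightarrow> 'x \<Rightarrow> 'x) \<Rightarrow> ('x \<Rightarrow> 'x \<Rightarrow> real) \<Rightarrow> 'g set \<Rightarrow> real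
      \<Rightarrow> nat \<Rightarrow> ('g \<Rightarrow> nat \<Rightarrow> nat) \<Rightarrow> ennreal" where
  "pressure_sum \<epsilon> f X \<alpha> \<rho> F \<delta> d \<sigma> =
     (SUP E\<in>{E. E \<subseteq> sofic_Map X \<alpha> \<rho> F \<delta> d \<sigma> \<and> separated (rho_inf \<rho> d) \<epsilon> E}.
        \<Sum>\<^sub>\<infinity>\<phi>\<in>E. ennreal (exp (\<Sum>a=1..d. f (\<phi> a))))"

definition elog :: "ennreal \<Rightarrow> ereal" where
  "elog x = (if x = 0 then -\<infinity> else if x = \<infinity> then \<infinity> else ereal (ln (enn2real x)))"

text \<open>
  The pressure and the entropy do not depend on the compatible metric \<open>\<rho>\<close>; it is kept as a
  parameter. Terms with \<open>d i = 0\<close> are irrelevant since \<open>d\<close> tends to infinity.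
\<close>

definition sofic_pressure ::
    "('g, 'r) monoid_scheme \<Rightarrow> 'x topology \<Rightarrow> ('g \<Rightarrow> 'x \<Rightarrow> 'x) \<Rightarrow> ('x \<Rightarrow> 'x \<Rightarrow> real)
      \<Rightarrow> (nat \<Rightarrow> nat) \<Rightarrow> (nat \<Rightarrow> 'g \<Rightarrow> nat \<Rightarrow> nat) \<Rightarrow> ('x \<Rightarrow> real) \<Rightarrow> ereal" where
  "sofic_pressure G X \<alpha> \<rho> d \<sigma> f =
     (SUP \<epsilon>\<in>{0<..}. INF F\<in>{F. finite F \<and> F \<noteq> {} \<and> F \<subseteq> carrier G}. INF \<delta>\<in>{0<..}.
        limsup (\<lambda>i. ereal (1 / real (d i)) * elog (pressure_sum \<epsilon> f X \<alpha> \<rho> F \<delta> (d i) (\<sigma> i))))"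

definition sofic_entropy ::
    "('g, 'r) monoid_scheme \<Rightarrow> 'x topology \<Rightarrow> ('g \<Rightarrow> 'x \<Rightarrow> 'x) \<Rightarrow> ('x \<Rightarrow> 'x \<Rightarrow> real)
      \<Rightarrow> (nat \<Rightarrow> nat) \<Rightarrow> (nat \<Rightarrow> 'g \<Rightarrow> nat \<Rightarrow> nat) \<Rightarrow> ereal" where
  "sofic_entropy G X \<alpha> \<rho> d \<sigma> =
     (SUP \<epsilon>\<in>{0<..}. INF F\<in>{F. finite F \<and> F \<noteq> {} \<and> F \<subseteq> carrier G}. INF \<delta>\<in>{0<..}.
        limsup (\<lambda>i. ereal (1 / real (d i)) *
          elog (separation_number \<epsilon> (sofic_Map X \<alpha> \<rho> F \<delta> (d i) (\<sigma> i)) (rho_inf \<rho> (d i)))))"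

definition constantly_on_C :: "'x topology \<Rightarrow> (('x \<Rightarrow> real) \<Rightarrow> ereal) \<Rightarrow> ereal \<Rightarrow> bool" where
  "constantly_on_C X P v \<longleftrightarrow> (\<forall>f. continuous_map X euclideanreal f \<longrightarrow> P f = v)"

end

theory Submission
  imports Defs
begin

text \<open>
  Up to the normalization \<open>1 / d\<close>, the pressure is a limit of functions
  \<open>f \<mapsto> ln (\<Sum>\<phi>\<in>E. exp (f(\<phi> 1) + \<dots> + f(\<phi> d)))\<close>, one for every finite separated family \<open>E\<close> of
  microstates. All of the properties come from two features of such a log-sum-exp function.

  The first is a form of Hoelder's inequality: for positive \<open>a\<close>, \<open>b\<close> with \<open>a + b \<ge> 1\<close>, the value at
  \<open>a u + b v\<close> is at most \<open>a\<close> times the value at \<open>u\<close> plus \<open>b\<close> times the value at \<open>v\<close>. The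
  suprema over \<open>E\<close> and \<open>\<epsilon>\<close> and the upper limit in \<open>i\<close> are subadditive, and so is the infimum over
  \<open>(F, \<delta>)\<close>, because the quantities decrease along the directed family of these parameters. So the
  inequality passes to the pressure (\<open>pressure_linear_bound\<close>). Subadditivity (\<open>a = b = 1\<close>),
  convexity (\<open>a + b = 1\<close>) and \<open>P (c f) \<le> c P f\<close> for \<open>c \<ge> 1\<close> (\<open>a = b = c / 2\<close>) are
  special cases.

  The second is monotonicity up to an additive constant: if the sums of \<open>u\<close> along all
  sufficiently good microstates exceed those of \<open>v\<close> by at most \<open>K d\<close>, then \<open>P u \<le> P v + K\<close>
  (\<open>pressure_comparison\<close>). This gives the behaviour under adding constants, monotonicity, and the
  bounds \<open>h + min f \<le> P f \<le> h + max f\<close>, where \<open>h = P 0\<close> is the entropy. As \<open>f\<close> is bounded, these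
  bounds show that \<open>P\<close> is finite everywhere or constantly \<open>\<plusminus>\<infinity>\<close>, according to \<open>h\<close>. It also gives
  the invariance under adding a coboundary \<open>g \<circ> \<alpha>\<^sub>s - g\<close>: for a microstate \<open>\<phi>\<close> the function
  \<open>g \<circ> \<alpha>\<^sub>s \<circ> \<phi>\<close> can be replaced by \<open>g \<circ> \<phi> \<circ> \<sigma>\<^sub>s\<close> at a small average cost, by uniform continuity of \<open>g\<close>,
  and the permutation \<open>\<sigma>\<^sub>s\<close> does not change the sum of \<open>g \<circ> \<phi>\<close>.

  The remaining claims are formal consequences. For instance \<open>P 0 \<ge> 0\<close> whenever \<open>P 0\<close> is finite,
  since \<open>P 0 \<le> P 0 + P 0\<close>; and for \<open>c \<le> 0\<close> the zero function is a convex combination of \<open>c f\<close> and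
  \<open>f\<close>, so that convexity bounds \<open>P (c f)\<close> from below.
\<close>

section \<open>Log-sum-exp functions\<close>

definition log_sum_exp :: "('a \<Rightarrow> real) \<Rightarrow> 'a set \<Rightarrow> real" where
  "log_sum_exp u E = ln (\<Sum>x\<in>E. exp (u x))"

lemma exp_log_sum_exp:
  assumes "finite E" "E \<noteq> {}"
  shows "exp (log_sum_exp u E) = (\<Sum>x\<in>E. exp (u x))"
  using assms by (simp add: log_sum_exp_def sum_pos)

lemma le_log_sum_exp:
  assumes "finite E" "x \<in> E"
  shows "u x \<le> log_sum_exp u E"
proof -
  have "exp (u x) \<le> (\<Sum>y\<in>E. exp (u y))"
    using assms by (intro member_le_sum) auto
  also have "\<dots> = exp (log_sum_exp u E)"
    using assms by (intro exp_log_sum_exp[symmetric]) auto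
  finally show ?thesis by simp
qed

lemma log_sum_exp_mono:
  assumes "finite E" "E \<noteq> {}" and le: "\<And>x. x \<in> E \<Longrightarrow> u x \<le> v x + k"
  shows "log_sum_exp u E \<le> log_sum_exp v E + k"
proof -
  have "exp (log_sum_exp u E) = (\<Sum>x\<in>E. exp (u x))"
    using assms by (simp add: exp_log_sum_exp)
  also have "\<dots> \<le> (\<Sum>x\<in>E. exp (v x) * exp k)"
    using le by (intro sum_mono) (simp flip: exp_add)
  also have "\<dots> = exp (log_sum_exp v E + k)"
    using assms by (simp add: exp_add exp_log_sum_exp sum_distrib_right)
  finally show ?thesis by simp
qed

text \<open>
  Both sides change by the same amount when constants are added to \<open>u\<close> and \<open>v\<close>, so one may assume
  that the exponentials of \<open>u\<close> and of \<open>v\<close> both sum to \<open>1\<close>. Then \<open>u\<close> and \<open>v\<close> are nonpositive, so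
  dividing the exponent \<open>a u + b v\<close> by \<open>a + b \<ge> 1\<close> only increases it, and what results is a convex
  combination of \<open>u\<close> and \<open>v\<close>, to which convexity of \<open>exp\<close> applies.
\<close>
lemma log_sum_exp_linear_bound:
  fixes u v :: "'a \<Rightarrow> real"
  assumes E: "finite E" "E \<noteq> {}" and a: "0 < a" and b: "0 < b" and ab: "1 \<le> a + b"
  shows "log_sum_exp (\<lambda>x. a * u x + b * v x) E \<le> a * log_sum_exp u E + b * log_sum_exp v E"
proof -
  define u' where "u' = (\<lambda>x. u x - log_sum_exp u E)"
  define v' where "v' = (\<lambda>x. v x - log_sum_exp v E)"
  have sum1: "(\<Sum>x\<in>E. exp (u' x)) = 1" "(\<Sum>x\<in>E. exp (v' x)) = 1"
    unfolding u'_def v'_def exp_diff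
    by (simp_all add: exp_log_sum_exp[OF E, symmetric] flip: sum_divide_distrib)
  have weight: "1 - b / (a + b) = a / (a + b)"
    using a b by (simp add: field_simps)
  have pointwise: "exp (a * u' x + b * v' x) \<le> (a / (a + b)) * exp (u' x) + (b / (a + b)) * exp (v' x)"
    if x: "x \<in> E" for x
  proof -
    have "a * u' x + b * v' x \<le> 0"
      using le_log_sum_exp[OF E(1) x, of u] le_log_sum_exp[OF E(1) x, of v] a b
      by (simp add: u'_def v'_def add_nonpos_nonpos mult_nonneg_nonpos)
    then have "(a * u' x + b * v' x) * (a + b) \<le> (a * u' x + b * v' x) * 1"
      using ab by (intro mult_left_mono_neg) auto
    then have "a * u' x + b * v' x \<le> (a * u' x + b * v' x) / (a + b)"
      using a b by (simp add: le_divide_eq)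
    also have "\<dots> = (1 - b / (a + b)) * u' x + b / (a + b) * v' x"
      unfolding weight by (simp add: add_divide_distrib)
    finally have "exp (a * u' x + b * v' x) \<le> exp ((1 - b / (a + b)) * u' x + b / (a + b) * v' x)"
      by simp
    also have "\<dots> \<le> (1 - b / (a + b)) * exp (u' x) + b / (a + b) * exp (v' x)"
      using convex_onD[OF exp_convex, of "b / (a + b)" "u' x" "v' x"] a b by simp
    finally show ?thesis unfolding weight .
  qed
  have "(\<Sum>x\<in>E. exp (a * u' x + b * v' x))
      \<le> (\<Sum>x\<in>E. (a / (a + b)) * exp (u' x) + (b / (a + b)) * exp (v' x))"
    using pointwise by (rule sum_mono)
  also have "\<dots> = a / (a + b) + b / (a + b)"
    by (simp only: sum.distrib sum1 mult_1_right flip: sum_distrib_left)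
  also have "\<dots> = 1"
    using a b by (simp flip: add_divide_distrib)
  finally have "exp (log_sum_exp (\<lambda>x. a * u' x + b * v' x) E) \<le> exp 0"
    using E by (simp add: exp_log_sum_exp)
  then have normalized: "log_sum_exp (\<lambda>x. a * u' x + b * v' x) E \<le> 0"
    by (simp only: exp_le_cancel_iff)
  have "log_sum_exp (\<lambda>x. a * u x + b * v x) E
      \<le> log_sum_exp (\<lambda>x. a * u' x + b * v' x) E + (a * log_sum_exp u E + b * log_sum_exp v E)"
    by (rule log_sum_exp_mono[OF E]) (simp add: u'_def v'_def algebra_simps)
  with normalized show ?thesis by simp
qed

section \<open>Logarithms of suprema of exponential sums\<close>

definition eexp :: "ereal \<Rightarrow> ennreal" where
  "eexp y = (if y = -\<infinity> then 0 else if y = \<infinity> then \<infinity> else ennreal (exp (real_of_ereal y)))"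

text \<open>
  This adjunction lets the logarithm pass through the suprema in the definition of the pressure.
\<close>
lemma elog_le_iff: "elog x \<le> y \<longleftrightarrow> x \<le> eexp y"
proof (cases x)
  case (real r)
  show ?thesis
  proof (cases "r = 0")
    case True
    then show ?thesis using real by (simp add: elog_def)
  next
    case False
    then have r: "0 < r" using real by simp
    have "elog x = ereal (ln r)"
      using r real by (simp add: elog_def)
    moreover have "ln r \<le> z \<longleftrightarrow> r \<le> exp z" for z
      by (metis exp_le_cancel_iff exp_ln r)
    ultimately show ?thesis
      using r real by (cases y) (auto simp: eexp_def)
  qed
next
  case top
  then show ?thesis by (cases y) (auto simp: elog_def eexp_def top_unique)
qed

lemma elog_mono: "x \<le> y \<Longrightarrow> elog x \<le> elog y"
  using elog_le_iff order_trans by blast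

lemma elog_ennreal: "0 < r \<Longrightarrow> elog (ennreal r) = ereal (ln r)"
  by (simp add: elog_def)

definition birkhoff :: "('x \<Rightarrow> real) \<Rightarrow> nat \<Rightarrow> (nat \<Rightarrow> 'x) \<Rightarrow> real" where
  "birkhoff f n \<phi> = (\<Sum>a=1..n. f (\<phi> a))"

text \<open>
  An unordered sum of nonnegative terms is the supremum of its finite subsums, and a subset of a
  separated set is separated. So finite families suffice, whatever the size of the separated
  sets; the empty family contributes \<open>elog 0 = -\<infinity>\<close> and may be left out.
\<close>
lemma elog_pressure_sum_le_iff:
  "elog (pressure_sum \<epsilon> f X \<alpha> \<rho> F \<delta> n \<tau>) \<le> y \<longleftrightarrow>
    (\<forall>E. finite E \<and> E \<noteq> {} \<and> E \<subseteq> sofic_Map X \<alpha> \<rho> F \<delta> n \<tau> \<and> separated (rho_inf \<rho> n) \<epsilon> E \<longrightarrow>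
      ereal (log_sum_exp (birkhoff f n) E) \<le> y)" (is "?L \<longleftrightarrow> ?R")
proof -
  let ?S = "\<lambda>E. (\<Sum>\<phi>\<in>E. ennreal (exp (birkhoff f n \<phi>)))"
  have finite_family: "elog (?S E) = ereal (log_sum_exp (birkhoff f n) E)"
    if "finite E" "E \<noteq> {}" for E
    using that by (simp add: log_sum_exp_def sum_pos elog_ennreal sum_ennreal)
  have infsum_le: "(\<Sum>\<^sub>\<infinity>\<phi>\<in>E. ennreal (exp (birkhoff f n \<phi>))) \<le> z \<longleftrightarrow>
      (\<forall>E'. finite E' \<and> E' \<subseteq> E \<longrightarrow> ?S E' \<le> z)" for E z
    by (subst nonneg_infsum_complete) (auto simp: SUP_le_iff)
  have "?L \<longleftrightarrow> (\<forall>E. E \<subseteq> sofic_Map X \<alpha> \<rho> F \<delta> n \<tau> \<and> separated (rho_inf \<rho> n) \<epsilon> E \<longrightarrow>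
      (\<Sum>\<^sub>\<infinity>\<phi>\<in>E. ennreal (exp (birkhoff f n \<phi>))) \<le> eexp y)"
    unfolding elog_le_iff pressure_sum_def birkhoff_def SUP_le_iff by blast
  also have "\<dots> \<longleftrightarrow> (\<forall>E. E \<subseteq> sofic_Map X \<alpha> \<rho> F \<delta> n \<tau> \<and> separated (rho_inf \<rho> n) \<epsilon> E \<longrightarrow>
      (\<forall>E'. finite E' \<and> E' \<subseteq> E \<longrightarrow> ?S E' \<le> eexp y))"
    unfolding infsum_le ..
  also have "\<dots> \<longleftrightarrow> (\<forall>E. finite E \<and> E \<subseteq> sofic_Map X \<alpha> \<rho> F \<delta> n \<tau> \<and>
      separated (rho_inf \<rho> n) \<epsilon> E \<longrightarrow> ?S E \<le> eexp y)"
    unfolding separated_def by (meson subset_iff subset_refl order_trans)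
  also have "\<dots> \<longleftrightarrow> (\<forall>E. finite E \<and> E \<noteq> {} \<and> E \<subseteq> sofic_Map X \<alpha> \<rho> F \<delta> n \<tau> \<and>
      separated (rho_inf \<rho> n) \<epsilon> E \<longrightarrow> ?S E \<le> eexp y)"
    by (metis sum.empty zero_le)
  also have "\<dots> \<longleftrightarrow> ?R"
    using finite_family unfolding elog_le_iff[symmetric] by metis
  finally show ?thesis .
qed

lemma log_sum_exp_le_elog_pressure_sum:
  assumes "finite E" "E \<noteq> {}" "E \<subseteq> sofic_Map X \<alpha> \<rho> F \<delta> n \<tau>" "separated (rho_inf \<rho> n) \<epsilon> E"
  shows "ereal (log_sum_exp (birkhoff f n) E) \<le> elog (pressure_sum \<epsilon> f X \<alpha> \<rho> F \<delta> n \<tau>)"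
  using elog_pressure_sum_le_iff[of \<epsilon> f X \<alpha> \<rho> F \<delta> n \<tau>] assms by blast

text \<open>For the zero function all the weights are \<open>1\<close>, so that the sum over a family counts it.\<close>
lemma pressure_sum_zero:
  "pressure_sum \<epsilon> (\<lambda>x. 0) X \<alpha> \<rho> F \<delta> n \<tau>
    = separation_number \<epsilon> (sofic_Map X \<alpha> \<rho> F \<delta> n \<tau>) (rho_inf \<rho> n)" (is "?L = ?R")
proof (rule antisym)
  have "(\<Sum>\<^sub>\<infinity>\<phi>\<in>E. ennreal 1) \<le> ?R"
    if E: "E \<subseteq> sofic_Map X \<alpha> \<rho> F \<delta> n \<tau>" "separated (rho_inf \<rho> n) \<epsilon> E" for E
  proof (subst nonneg_infsum_complete)
    show "(SUP E'\<in>{E'. finite E' \<and> E' \<subseteq> E}. \<Sum>\<phi>\<in>E'. ennreal 1) \<le> ?R"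
      unfolding separation_number_def using E
      by (intro SUP_mono) (auto simp: separated_def intro!: exI)
  qed simp
  then show "?L \<le> ?R"
    unfolding pressure_sum_def by (intro SUP_least) auto
  have "of_nat (card E) \<le> ?L"
    if "finite E" "E \<subseteq> sofic_Map X \<alpha> \<rho> F \<delta> n \<tau>" "separated (rho_inf \<rho> n) \<epsilon> E" for E
    unfolding pressure_sum_def using that by (intro SUP_upper2[of E]) auto
  then show "?R \<le> ?L"
    unfolding separation_number_def by (intro SUP_least) auto
qed

section \<open>The limit over approximation parameters\<close>

definition sofic_limit :: "'g set \<Rightarrow> (real \<Rightarrow> 'g set \<Rightarrow> real \<Rightarrow> nat \<Rightarrow> ereal) \<Rightarrow> ereal" where
  "sofic_limit S Q = (SUP \<epsilon>\<in>{0<..}. INF F\<in>{F. finite F \<and> F \<noteq> {} \<and> F \<subseteq> S}. INF \<delta>\<in>{0<..}.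
     limsup (Q \<epsilon> F \<delta>))"

definition antitone_tightening :: "(real \<Rightarrow> 'g set \<Rightarrow> real \<Rightarrow> nat \<Rightarrow> ereal) \<Rightarrow> bool" where
  "antitone_tightening Q \<longleftrightarrow> (\<forall>\<epsilon> F F' \<delta> \<delta>' i. finite F' \<and> F \<noteq> {} \<and> F \<subseteq> F' \<and> \<delta>' \<le> \<delta> \<longrightarrow>
     Q \<epsilon> F' \<delta>' i \<le> Q \<epsilon> F \<delta> i)"

lemma antitone_tighteningD:
  assumes "antitone_tightening Q" "finite F'" "F \<noteq> {}" "F \<subseteq> F'" "\<delta>' \<le> \<delta>"
  shows "Q \<epsilon> F' \<delta>' i \<le> Q \<epsilon> F \<delta> i"
  using assms unfolding antitone_tightening_def by blast

lemma INF_INF_eq_INF_Times: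
  fixes f :: "'a \<Rightarrow> 'b \<Rightarrow> ereal"
  shows "(INF x\<in>A. INF y\<in>B. f x y) = (INF p\<in>A \<times> B. f (fst p) (snd p))"
proof (rule antisym)
  show "(INF x\<in>A. INF y\<in>B. f x y) \<le> (INF p\<in>A \<times> B. f (fst p) (snd p))"
    by (rule INF_greatest) (auto intro!: INF_lower2 order_refl)
  show "(INF p\<in>A \<times> B. f (fst p) (snd p)) \<le> (INF x\<in>A. INF y\<in>B. f x y)"
    by (intro INF_greatest) (auto intro!: INF_lower2 order_refl)
qed

text \<open>
  The two infima may be approached independently through real upper bounds. If one of them is \<open>\<infinity>\<close>,
  then so is the right hand side, since \<open>\<infinity> + (-\<infinity>) = \<infinity>\<close>.
\<close>
lemma le_linear_combination_INF:
  fixes A B :: "'p \<Rightarrow> ereal"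
  assumes a: "0 < a" and b: "0 < b"
    and le: "\<And>p q. p \<in> I \<Longrightarrow> q \<in> I \<Longrightarrow> L \<le> ereal a * A p + ereal b * B q"
  shows "L \<le> ereal a * (INF p\<in>I. A p) + ereal b * (INF q\<in>I. B q)"
proof -
  define \<alpha> where "\<alpha> = (INF p\<in>I. A p)"
  define \<beta> where "\<beta> = (INF q\<in>I. B q)"
  have approx: "L \<le> ereal (a * x + b * y)" if x: "\<alpha> < ereal x" and y: "\<beta> < ereal y" for x y
  proof -
    obtain p where p: "p \<in> I" "A p < ereal x" using x by (auto simp: \<alpha>_def INF_less_iff)
    obtain q where q: "q \<in> I" "B q < ereal y" using y by (auto simp: \<beta>_def INF_less_iff)
    have "L \<le> ereal a * A p + ereal b * B q"
      using le p q by blast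
    also have "\<dots> \<le> ereal a * ereal x + ereal b * ereal y"
      using p q a b by (intro add_mono ereal_mult_left_mono) auto
    finally show ?thesis by simp
  qed
  show ?thesis
  proof (cases "\<alpha> = \<infinity> \<or> \<beta> = \<infinity>")
    case True
    then show ?thesis using a b unfolding \<alpha>_def[symmetric] \<beta>_def[symmetric] by auto
  next
    case False
    have "L \<le> z" if z: "ereal a * \<alpha> + ereal b * \<beta> < z" for z
    proof -
      have "\<exists>x y. \<alpha> < ereal x \<and> \<beta> < ereal y \<and> ereal (a * x + b * y) \<le> z"
      proof (cases z)
        case (real r)
        show ?thesis
        proof (cases \<alpha>)
          case (real \<alpha>')
          note \<alpha>' = real
          show ?thesis
          proof (cases \<beta>)
            case (real \<beta>')
            \<comment> \<open>the gap \<open>r - (a \<alpha>' + b \<beta>')\<close> is split evenly between the two summands\<close>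
            define e where "e = (r - (a * \<alpha>' + b * \<beta>')) / 2"
            have "0 < e" using z real \<alpha>' \<open>z = ereal r\<close> by (simp add: e_def)
            then show ?thesis
              using real \<alpha>' \<open>z = ereal r\<close> a b
              by (intro exI[of _ "\<alpha>' + e / a"] exI[of _ "\<beta>' + e / b"]) (auto simp: e_def field_simps)
          next
            case MInf
            then show ?thesis
              using \<alpha>' \<open>z = ereal r\<close> b
              by (intro exI[of _ "\<alpha>' + 1"] exI[of _ "(r - a * (\<alpha>' + 1)) / b"]) auto
          qed (use False in auto)
        next
          case MInf
          obtain y where "\<beta> < ereal y" using False by (metis less_PInf_Ex_of_nat)
          then show ?thesis
            using MInf \<open>z = ereal r\<close> a
            by (intro exI[of _ "(r - b * y) / a"] exI[of _ y]) auto
        qed (use False in auto)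
      next
        case PInf
        obtain x y where "\<alpha> < ereal x" "\<beta> < ereal y"
          using False by (metis less_PInf_Ex_of_nat)
        then show ?thesis using PInf by auto
      qed (use z in auto)
      then show ?thesis using approx order_trans by blast
    qed
    then show ?thesis unfolding \<alpha>_def[symmetric] \<beta>_def[symmetric] by (rule dense_ge)
  qed
qed

text \<open>
  A linear bound that holds for all sufficiently tight parameters \<open>(F, \<delta>)\<close> and eventually in \<open>i\<close>
  survives in the limit. Parameters that almost realize the infima of \<open>R\<close> and of \<open>T\<close> have a common
  tightening \<open>(F\<^sub>0 \<union> F\<^sub>1 \<union> F\<^sub>2, min \<delta>\<^sub>0 (min \<delta>\<^sub>1 \<delta>\<^sub>2))\<close>, at which \<open>R\<close> and \<open>T\<close> are only smaller.
\<close>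
lemma sofic_limit_linear_bound:
  fixes Q R T :: "real \<Rightarrow> 'g set \<Rightarrow> real \<Rightarrow> nat \<Rightarrow> ereal"
  assumes a: "0 < a" and b: "0 < b"
    and R: "antitone_tightening R" and T: "antitone_tightening T"
    and F0: "finite F\<^sub>0" "F\<^sub>0 \<noteq> {}" "F\<^sub>0 \<subseteq> S" and \<delta>0: "(0::real) < \<delta>\<^sub>0"
    and le: "\<And>\<epsilon> F \<delta>. 0 < \<epsilon> \<Longrightarrow> finite F \<Longrightarrow> F\<^sub>0 \<subseteq> F \<Longrightarrow> F \<subseteq> S \<Longrightarrow> 0 < \<delta> \<Longrightarrow> \<delta> \<le> \<delta>\<^sub>0 \<Longrightarrow>
      \<forall>\<^sub>F i in sequentially. Q \<epsilon> F \<delta> i \<le> ereal a * R \<epsilon> F \<delta> i + ereal b * T \<epsilon> F \<delta> i"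
  shows "sofic_limit S Q \<le> ereal a * sofic_limit S R + ereal b * sofic_limit S T"
proof -
  let ?I = "{F. finite F \<and> F \<noteq> {} \<and> F \<subseteq> S} \<times> {0::real<..}"
  define inner where
    "inner Q \<epsilon> = (INF p\<in>?I. limsup (Q \<epsilon> (fst p) (snd p)))"
    for Q :: "real \<Rightarrow> 'g set \<Rightarrow> real \<Rightarrow> nat \<Rightarrow> ereal" and \<epsilon>
  have limit_eq: "sofic_limit S Q = (SUP \<epsilon>\<in>{0<..}. inner Q \<epsilon>)" for Q
    by (simp add: sofic_limit_def inner_def INF_INF_eq_INF_Times)
  have "inner Q \<epsilon> \<le> ereal a * inner R \<epsilon> + ereal b * inner T \<epsilon>" if \<epsilon>: "0 < \<epsilon>" for \<epsilon>
    unfolding inner_def[of R] inner_def[of T]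
  proof (rule le_linear_combination_INF[OF a b])
    fix p q assume p: "p \<in> ?I" and q: "q \<in> ?I"
    define F where "F = F\<^sub>0 \<union> fst p \<union> fst q"
    define \<delta> where "\<delta> = min \<delta>\<^sub>0 (min (snd p) (snd q))"
    have F: "finite F" "F\<^sub>0 \<subseteq> F" "F \<subseteq> S" "F \<noteq> {}" and \<delta>: "0 < \<delta>" "\<delta> \<le> \<delta>\<^sub>0"
      using p q F0 \<delta>0 by (auto simp: F_def \<delta>_def)
    have "inner Q \<epsilon> \<le> limsup (Q \<epsilon> F \<delta>)"
      unfolding inner_def using F \<delta> by (intro INF_lower2[of "(F, \<delta>)"]) auto
    also have "\<dots> \<le> limsup (\<lambda>i. ereal a * R \<epsilon> F \<delta> i + ereal b * T \<epsilon> F \<delta> i)"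
      using F \<delta> \<epsilon> by (intro Limsup_mono le) auto
    also have "\<dots> \<le> limsup (\<lambda>i. ereal a * R \<epsilon> F \<delta> i) + limsup (\<lambda>i. ereal b * T \<epsilon> F \<delta> i)"
      by (rule ereal_limsup_add_mono)
    also have "\<dots> = ereal a * limsup (R \<epsilon> F \<delta>) + ereal b * limsup (T \<epsilon> F \<delta>)"
      using a b by (simp add: limsup_ereal_mult_left)
    also have "\<dots> \<le> ereal a * limsup (R \<epsilon> (fst p) (snd p)) + ereal b * limsup (T \<epsilon> (fst q) (snd q))"
    proof (intro add_mono ereal_mult_left_mono Limsup_mono always_eventually allI)
      fix i
      show "R \<epsilon> F \<delta> i \<le> R \<epsilon> (fst p) (snd p) i"
        using p F by (intro antitone_tighteningD[OF R]) (auto simp: F_def \<delta>_def)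
      show "T \<epsilon> F \<delta> i \<le> T \<epsilon> (fst q) (snd q) i"
        using q F by (intro antitone_tighteningD[OF T]) (auto simp: F_def \<delta>_def)
    qed (use a b in auto)
    finally show "inner Q \<epsilon> \<le> ereal a * limsup (R \<epsilon> (fst p) (snd p)) + ereal b * limsup (T \<epsilon> (fst q) (snd q))" .
  qed
  also have "ereal a * inner R \<epsilon> + ereal b * inner T \<epsilon> \<le> ereal a * sofic_limit S R + ereal b * sofic_limit S T"
    if "0 < \<epsilon>" for \<epsilon>
    using that a b unfolding limit_eq by (intro add_mono ereal_mult_left_mono SUP_upper) auto
  finally show ?thesis
    unfolding limit_eq[of Q] by (intro SUP_least) auto
qed

lemma sofic_limit_const:
  assumes "S \<noteq> {}"
  shows "sofic_limit S (\<lambda>\<epsilon> F \<delta> i. k) = k"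
proof -
  have "{F. finite F \<and> F \<noteq> {} \<and> F \<subseteq> S} \<noteq> {}"
    using assms by (auto intro: exI[of _ "{_}"])
  then show ?thesis
    by (simp add: sofic_limit_def Limsup_const)
qed

section \<open>Microstates\<close>

lemma sofic_Map_tightening:
  assumes "finite F'" "F \<noteq> {}" "F \<subseteq> F'" "\<delta>' \<le> \<delta>"
  shows "sofic_Map X \<alpha> \<rho> F' \<delta>' n \<tau> \<subseteq> sofic_Map X \<alpha> \<rho> F \<delta> n \<tau>"
proof -
  have "(MAX s\<in>F. rho_2 \<rho> n (\<alpha> s \<circ> \<phi>) (\<phi> \<circ> \<tau> s)) \<le> (MAX s\<in>F'. rho_2 \<rho> n (\<alpha> s \<circ> \<phi>) (\<phi> \<circ> \<tau> s))"
    for \<phi>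
    using assms by (intro Max_mono) auto
  then show ?thesis
    using assms(4) unfolding sofic_Map_def by (blast intro: le_less_trans less_le_trans)
qed

lemma sofic_Map_in_topspace:
  "\<phi> \<in> sofic_Map X \<alpha> \<rho> F \<delta> n \<tau> \<Longrightarrow> a \<in> {1..n} \<Longrightarrow> \<phi> a \<in> topspace X"
  by (auto simp: sofic_Map_def)

lemma bounded_continuous_map_image:
  assumes "compact_space X" "continuous_map X euclideanreal u"
  shows "bounded (u ` topspace X)"
proof -
  have "compactin X (topspace X)"
    using assms(1) by (simp add: compact_space_def)
  then have "compactin euclideanreal (u ` topspace X)"
    using assms(2) by (rule image_compactin)
  then show ?thesis by (simp add: compact_imp_bounded)
qed

text \<open>
  A quadratic form of uniform continuity: where \<open>\<rho>\<close> is small the oscillation of \<open>g\<close> is at most \<open>\<kappa>\<close>,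
  and elsewhere a large multiple of \<open>\<rho>\<^sup>2\<close> exceeds twice the bound on \<open>g\<close>. The square is what the mean
  square distance \<open>\<rho>\<^sub>2\<close> of microstates controls.
\<close>
lemma quadratic_modulus_of_continuity:
  assumes cpt: "compact_space X" and \<rho>: "compatible_metric X \<rho>"
    and g: "continuous_map X euclideanreal g" and \<kappa>: "0 < \<kappa>"
  obtains C where "0 \<le> C"
    "\<And>x y. x \<in> topspace X \<Longrightarrow> y \<in> topspace X \<Longrightarrow> \<bar>g x - g y\<bar> \<le> \<kappa> + C * (\<rho> x y)\<^sup>2"
proof -
  interpret Metric_space "topspace X" \<rho>
    using \<rho> by (simp add: compatible_metric_def)
  have X: "mtopology = X"
    using \<rho> by (simp add: compatible_metric_def)
  let ?U = "\<lambda>z. {x \<in> topspace X. g x \<in> ball (g z) (\<kappa> / 2)}"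
  have open_U: "openin mtopology (?U z)" for z
    unfolding X using g by (rule openin_continuous_map_preimage) auto
  have "\<exists>r>0. \<forall>x\<in>topspace X. \<exists>U\<in>?U ` topspace X. mball x r \<subseteq> U"
  proof (rule lebesgue_number)
    show "compactin mtopology (topspace X)"
      using cpt by (simp add: X compact_space_def)
    show "topspace X \<subseteq> \<Union> (?U ` topspace X)"
      using \<kappa> by auto
  qed (use open_U in auto)
  then obtain r where r: "0 < r" "\<And>x. x \<in> topspace X \<Longrightarrow> \<exists>z. mball x r \<subseteq> ?U z"
    by (metis (no_types, lifting) imageE)
  have near: "\<bar>g x - g y\<bar> \<le> \<kappa>" if xy: "x \<in> topspace X" "y \<in> topspace X" "\<rho> x y < r" for x y
  proof -
    obtain z where z: "mball x r \<subseteq> ?U z" using r xy by blast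
    have "x \<in> ?U z" "y \<in> ?U z" using z xy r by auto
    then have "\<bar>g z - g x\<bar> < \<kappa> / 2" "\<bar>g z - g y\<bar> < \<kappa> / 2"
      by (simp_all add: dist_real_def)
    then show ?thesis by linarith
  qed
  obtain B where B: "0 < B" "\<And>x. x \<in> topspace X \<Longrightarrow> \<bar>g x\<bar> \<le> B"
    using bounded_continuous_map_image[OF cpt g] by (auto simp: bounded_pos)
  show ?thesis
  proof (rule that[of "2 * B / r\<^sup>2"])
    show "0 \<le> 2 * B / r\<^sup>2" using B by simp
    fix x y assume xy: "x \<in> topspace X" "y \<in> topspace X"
    show "\<bar>g x - g y\<bar> \<le> \<kappa> + 2 * B / r\<^sup>2 * (\<rho> x y)\<^sup>2"
    proof (cases "\<rho> x y < r")
      case True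
      moreover have "0 \<le> 2 * B / r\<^sup>2 * (\<rho> x y)\<^sup>2" using B by simp
      ultimately show ?thesis using near[OF xy] by linarith
    next
      case False
      then have "r\<^sup>2 \<le> (\<rho> x y)\<^sup>2" using r by (intro power_mono) auto
      then have "2 * B \<le> 2 * B / r\<^sup>2 * (\<rho> x y)\<^sup>2"
        using r B by (simp add: field_simps)
      then show ?thesis using B(2)[OF xy(1)] B(2)[OF xy(2)] \<kappa> by linarith
    qed
  qed
qed

lemma sum_sq_less_of_rho_2_less:
  assumes "rho_2 \<rho> n \<phi> \<psi> < \<delta>" and n: "0 < n"
  shows "(\<Sum>a=1..n. (\<rho> (\<phi> a) (\<psi> a))\<^sup>2) \<le> real n * \<delta>\<^sup>2"
proof -
  have "rho_2 \<rho> n \<phi> \<psi> \<ge> 0"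
    by (simp add: rho_2_def sum_nonneg)
  then have "(rho_2 \<rho> n \<phi> \<psi>)\<^sup>2 \<le> \<delta>\<^sup>2"
    using assms by (intro power_mono) auto
  moreover have "(rho_2 \<rho> n \<phi> \<psi>)\<^sup>2 = 1 / real n * (\<Sum>a=1..n. (\<rho> (\<phi> a) (\<psi> a))\<^sup>2)"
    unfolding rho_2_def by (intro real_sqrt_pow2) (simp add: sum_nonneg)
  ultimately show ?thesis using n by (simp add: field_simps)
qed

text \<open>
  Since \<open>\<tau>\<^sub>s\<close> permutes the index set, \<open>g \<circ> \<phi>\<close> may be replaced by \<open>g \<circ> \<phi> \<circ> \<tau>\<^sub>s\<close> inside the sum, and
  almost equivariance of \<open>\<phi>\<close> in mean square makes \<open>\<phi> \<circ> \<tau>\<^sub>s\<close> close to \<open>\<alpha>\<^sub>s \<circ> \<phi>\<close>.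
\<close>
lemma birkhoff_coboundary_bound:
  assumes \<phi>: "\<phi> \<in> sofic_Map X \<alpha> \<rho> {s} \<delta> n \<tau>" and n: "0 < n"
    and perm: "\<tau> s permutes {1..n}"
    and \<alpha>: "\<And>x. x \<in> topspace X \<Longrightarrow> \<alpha> s x \<in> topspace X"
    and C: "0 \<le> C"
      "\<And>x y. x \<in> topspace X \<Longrightarrow> y \<in> topspace X \<Longrightarrow> \<bar>g x - g y\<bar> \<le> \<kappa> + C * (\<rho> x y)\<^sup>2"
  shows "\<bar>birkhoff (\<lambda>x. g (\<alpha> s x) - g x) n \<phi>\<bar> \<le> (\<kappa> + C * \<delta>\<^sup>2) * real n"
proof -
  have \<phi>X: "\<phi> a \<in> topspace X" "\<phi> (\<tau> s a) \<in> topspace X" if "a \<in> {1..n}" for a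
    using sofic_Map_in_topspace[OF \<phi>] that permutes_in_image[OF perm] by blast+
  have "rho_2 \<rho> n (\<alpha> s \<circ> \<phi>) (\<phi> \<circ> \<tau> s) < \<delta>"
    using \<phi> by (simp add: sofic_Map_def)
  note sq = sum_sq_less_of_rho_2_less[OF this n]
  have "(\<Sum>a=1..n. g (\<phi> a)) = (\<Sum>a=1..n. g (\<phi> (\<tau> s a)))"
    using sum.permute[OF perm, of "\<lambda>a. g (\<phi> a)"] by (simp add: o_def)
  then have "birkhoff (\<lambda>x. g (\<alpha> s x) - g x) n \<phi> = (\<Sum>a=1..n. g (\<alpha> s (\<phi> a)) - g (\<phi> (\<tau> s a)))"
    by (simp add: birkhoff_def sum_subtractf)
  also have "\<bar>\<dots>\<bar> \<le> (\<Sum>a=1..n. \<bar>g (\<alpha> s (\<phi> a)) - g (\<phi> (\<tau> s a))\<bar>)"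
    by (rule sum_abs)
  also have "\<dots> \<le> (\<Sum>a=1..n. \<kappa> + C * (\<rho> (\<alpha> s (\<phi> a)) (\<phi> (\<tau> s a)))\<^sup>2)"
    using \<phi>X \<alpha> by (intro sum_mono C) auto
  also have "\<dots> = real n * \<kappa> + C * (\<Sum>a=1..n. (\<rho> ((\<alpha> s \<circ> \<phi>) a) ((\<phi> \<circ> \<tau> s) a))\<^sup>2)"
    by (simp add: sum.distrib sum_distrib_left)
  also have "\<dots> \<le> real n * \<kappa> + C * (real n * \<delta>\<^sup>2)"
    using sq C by (intro add_left_mono mult_left_mono) auto
  finally show ?thesis by (simp add: algebra_simps)
qed

section \<open>The pressure functional\<close>

locale sofic_system =
  fixes G :: "('g, 'r) monoid_scheme"
    and X :: "'x topology"
    and \<alpha> :: "'g \<Rightarrow> 'x \<Rightarrow> 'x"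
    and \<rho> :: "'x \<Rightarrow> 'x \<Rightarrow> real"
    and d :: "nat \<Rightarrow> nat"
    and \<sigma> :: "nat \<Rightarrow> 'g \<Rightarrow> nat \<Rightarrow> nat"
  assumes compact: "compact_space X"
    and metric: "compatible_metric X \<rho>"
    and action: "continuous_group_action G X \<alpha>"
    and approximation: "sofic_approximation G d \<sigma>"
begin

abbreviation P :: "('x \<Rightarrow> real) \<Rightarrow> ereal" where
  "P \<equiv> sofic_pressure G X \<alpha> \<rho> d \<sigma>"

abbreviation h :: ereal where
  "h \<equiv> sofic_entropy G X \<alpha> \<rho> d \<sigma>"

definition pressure_rate :: "('x \<Rightarrow> real) \<Rightarrow> real \<Rightarrow> 'g set \<Rightarrow> real \<Rightarrow> nat \<Rightarrow> ereal" where
  "pressure_rate f \<epsilon> F \<delta> =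
    (\<lambda>i. ereal (1 / real (d i)) * elog (pressure_sum \<epsilon> f X \<alpha> \<rho> F \<delta> (d i) (\<sigma> i)))"

lemma pressure_eq_sofic_limit: "P f = sofic_limit (carrier G) (pressure_rate f)"
  by (simp add: sofic_pressure_def sofic_limit_def pressure_rate_def)

lemma eventually_d_pos: "\<forall>\<^sub>F i in sequentially. 0 < d i"
proof -
  have "\<forall>\<^sub>F i in sequentially. 1 \<le> d i"
    using approximation unfolding sofic_approximation_def filterlim_at_top by blast
  then show ?thesis by eventually_elim simp
qed

lemma action_in_topspace:
  "s \<in> carrier G \<Longrightarrow> x \<in> topspace X \<Longrightarrow> \<alpha> s x \<in> topspace X"
  using action continuous_map_image_subset_topspace unfolding continuous_group_action_def by blast

lemma one_in_carrier: "\<one>\<^bsub>G\<^esub> \<in> carrier G"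
proof -
  have "group_hom G (BijGroup (topspace X)) \<alpha>"
    using action by (simp add: continuous_group_action_def group_action_def)
  then show ?thesis
    by (simp add: group_hom_def group.is_monoid monoid.one_closed)
qed

lemma antitone_tightening_pressure_rate: "antitone_tightening (pressure_rate f)"
  unfolding antitone_tightening_def
proof (intro allI impI)
  fix \<epsilon> \<delta> \<delta>' :: real and F F' :: "'g set" and i :: nat
  assume "finite F' \<and> F \<noteq> {} \<and> F \<subseteq> F' \<and> \<delta>' \<le> \<delta>"
  then have "sofic_Map X \<alpha> \<rho> F' \<delta>' (d i) (\<sigma> i) \<subseteq> sofic_Map X \<alpha> \<rho> F \<delta> (d i) (\<sigma> i)"
    by (intro sofic_Map_tightening) auto
  then have "pressure_sum \<epsilon> f X \<alpha> \<rho> F' \<delta>' (d i) (\<sigma> i) \<le> pressure_sum \<epsilon> f X \<alpha> \<rho> F \<delta> (d i) (\<sigma> i)"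
    unfolding pressure_sum_def by (intro SUP_subset_mono) auto
  then show "pressure_rate f \<epsilon> F' \<delta>' i \<le> pressure_rate f \<epsilon> F \<delta> i"
    unfolding pressure_rate_def by (intro ereal_mult_left_mono elog_mono) auto
qed

lemma pressure_linear_bound:
  assumes a: "0 < a" and b: "0 < b" and ab: "1 \<le> a + b"
  shows "P (\<lambda>x. a * u x + b * v x) \<le> ereal a * P u + ereal b * P v"
  unfolding pressure_eq_sofic_limit
proof (rule sofic_limit_linear_bound[OF a b antitone_tightening_pressure_rate
      antitone_tightening_pressure_rate, where F\<^sub>0 = "{\<one>\<^bsub>G\<^esub>}" and \<delta>\<^sub>0 = 1])
  fix \<epsilon> \<delta> :: real and F :: "'g set"
  show "\<forall>\<^sub>F i in sequentially. pressure_rate (\<lambda>x. a * u x + b * v x) \<epsilon> F \<delta> i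
      \<le> ereal a * pressure_rate u \<epsilon> F \<delta> i + ereal b * pressure_rate v \<epsilon> F \<delta> i"
    using eventually_d_pos
  proof eventually_elim
    case (elim i)
    let ?L = "\<lambda>f. elog (pressure_sum \<epsilon> f X \<alpha> \<rho> F \<delta> (d i) (\<sigma> i))"
    have birkhoff_linear: "birkhoff (\<lambda>x. a * u x + b * v x) (d i)
        = (\<lambda>\<phi>. a * birkhoff u (d i) \<phi> + b * birkhoff v (d i) \<phi>)"
      by (simp add: fun_eq_iff birkhoff_def sum.distrib sum_distrib_left)
    have "?L (\<lambda>x. a * u x + b * v x) \<le> ereal a * ?L u + ereal b * ?L v"
      unfolding elog_pressure_sum_le_iff
    proof (intro allI impI, elim conjE)
      fix E assume E: "finite E" "E \<noteq> {}" "E \<subseteq> sofic_Map X \<alpha> \<rho> F \<delta> (d i) (\<sigma> i)"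
        "separated (rho_inf \<rho> (d i)) \<epsilon> E"
      have "ereal (log_sum_exp (birkhoff (\<lambda>x. a * u x + b * v x) (d i)) E)
          \<le> ereal a * ereal (log_sum_exp (birkhoff u (d i)) E)
            + ereal b * ereal (log_sum_exp (birkhoff v (d i)) E)"
        using log_sum_exp_linear_bound[OF E(1,2) a b ab] by (simp add: birkhoff_linear)
      also have "\<dots> \<le> ereal a * ?L u + ereal b * ?L v"
        using a b by (intro add_mono ereal_mult_left_mono log_sum_exp_le_elog_pressure_sum E) auto
      finally show "ereal (log_sum_exp (birkhoff (\<lambda>x. a * u x + b * v x) (d i)) E)
          \<le> ereal a * ?L u + ereal b * ?L v" .
    qed
    then have "ereal (1 / real (d i)) * ?L (\<lambda>x. a * u x + b * v x)
        \<le> ereal (1 / real (d i)) * (ereal a * ?L u + ereal b * ?L v)"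
      by (intro ereal_mult_left_mono) auto
    also have "\<dots> = ereal a * (ereal (1 / real (d i)) * ?L u) + ereal b * (ereal (1 / real (d i)) * ?L v)"
      using a b elim by (cases "?L u"; cases "?L v") (auto simp: add_divide_distrib)
    finally show ?case by (simp add: pressure_rate_def)
  qed
qed (use one_in_carrier in auto)

text \<open>
  Only the microstates of one tightness \<open>(F\<^sub>0, \<delta>\<^sub>0)\<close> matter, because the infimum over \<open>(F, \<delta>)\<close> may be
  restricted to tighter parameters.
\<close>
lemma pressure_comparison:
  assumes F0: "finite F\<^sub>0" "F\<^sub>0 \<noteq> {}" "F\<^sub>0 \<subseteq> carrier G" and \<delta>0: "0 < \<delta>\<^sub>0"
    and le: "\<And>i \<phi>. 0 < d i \<Longrightarrow> \<phi> \<in> sofic_Map X \<alpha> \<rho> F\<^sub>0 \<delta>\<^sub>0 (d i) (\<sigma> i) \<Longrightarrow>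
      birkhoff u (d i) \<phi> \<le> birkhoff v (d i) \<phi> + k * real (d i)"
  shows "P u \<le> P v + ereal k"
proof -
  have "sofic_limit (carrier G) (pressure_rate u)
      \<le> ereal 1 * sofic_limit (carrier G) (pressure_rate v)
        + ereal 1 * sofic_limit (carrier G) (\<lambda>\<epsilon> F \<delta> i. ereal k)"
  proof (rule sofic_limit_linear_bound[OF _ _ antitone_tightening_pressure_rate _ F0 \<delta>0])
    show "antitone_tightening (\<lambda>\<epsilon> (F :: 'g set) \<delta> i. ereal k)"
      by (simp add: antitone_tightening_def)
    fix \<epsilon> \<delta> :: real and F :: "'g set"
    assume F: "finite F" "F\<^sub>0 \<subseteq> F" and \<delta>: "\<delta> \<le> \<delta>\<^sub>0"
    show "\<forall>\<^sub>F i in sequentially. pressure_rate u \<epsilon> F \<delta> i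
        \<le> ereal 1 * pressure_rate v \<epsilon> F \<delta> i + ereal 1 * ereal k"
      using eventually_d_pos
    proof eventually_elim
      case (elim i)
      let ?L = "\<lambda>f. elog (pressure_sum \<epsilon> f X \<alpha> \<rho> F \<delta> (d i) (\<sigma> i))"
      have tight: "sofic_Map X \<alpha> \<rho> F \<delta> (d i) (\<sigma> i) \<subseteq> sofic_Map X \<alpha> \<rho> F\<^sub>0 \<delta>\<^sub>0 (d i) (\<sigma> i)"
        using F F0 \<delta> by (intro sofic_Map_tightening) auto
      have "?L u \<le> ?L v + ereal (k * real (d i))"
        unfolding elog_pressure_sum_le_iff
      proof (intro allI impI, elim conjE)
        fix E assume E: "finite E" "E \<noteq> {}" "E \<subseteq> sofic_Map X \<alpha> \<rho> F \<delta> (d i) (\<sigma> i)"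
          "separated (rho_inf \<rho> (d i)) \<epsilon> E"
        have "ereal (log_sum_exp (birkhoff u (d i)) E)
            \<le> ereal (log_sum_exp (birkhoff v (d i)) E) + ereal (k * real (d i))"
          using E tight elim by (simp add: log_sum_exp_mono le subset_iff)
        also have "\<dots> \<le> ?L v + ereal (k * real (d i))"
          by (intro add_mono log_sum_exp_le_elog_pressure_sum E order_refl)
        finally show "ereal (log_sum_exp (birkhoff u (d i)) E) \<le> ?L v + ereal (k * real (d i))" .
      qed
      then have "ereal (1 / real (d i)) * ?L u \<le> ereal (1 / real (d i)) * (?L v + ereal (k * real (d i)))"
        by (intro ereal_mult_left_mono) auto
      also have "\<dots> = ereal (1 / real (d i)) * ?L v + ereal k"
        using elim by (cases "?L v") (auto simp: field_simps)
      finally show ?case by (simp add: pressure_rate_def flip: one_ereal_def)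
    qed
  qed auto
  moreover have "sofic_limit (carrier G) (\<lambda>\<epsilon> F \<delta> i. ereal k) = ereal k"
    using one_in_carrier by (intro sofic_limit_const) auto
  ultimately show ?thesis
    by (simp add: pressure_eq_sofic_limit flip: one_ereal_def)
qed

lemma pressure_mono_const:
  assumes "\<And>x. x \<in> topspace X \<Longrightarrow> u x \<le> v x + k"
  shows "P u \<le> P v + ereal k"
proof (rule pressure_comparison[of "{\<one>\<^bsub>G\<^esub>}" 1])
  fix i \<phi> assume \<phi>: "\<phi> \<in> sofic_Map X \<alpha> \<rho> {\<one>\<^bsub>G\<^esub>} 1 (d i) (\<sigma> i)"
  have "birkhoff u (d i) \<phi> \<le> (\<Sum>a=1..d i. v (\<phi> a) + k)"
    unfolding birkhoff_def using sofic_Map_in_topspace[OF \<phi>] by (intro sum_mono assms) auto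
  then show "birkhoff u (d i) \<phi> \<le> birkhoff v (d i) \<phi> + k * real (d i)"
    by (simp add: birkhoff_def sum.distrib mult.commute)
qed (use one_in_carrier in auto)

lemma pressure_mono:
  assumes "\<And>x. x \<in> topspace X \<Longrightarrow> u x \<le> v x"
  shows "P u \<le> P v"
  using pressure_mono_const[of u v 0] assms by (simp flip: zero_ereal_def)

lemma pressure_zero_eq_entropy: "P (\<lambda>x. 0) = h"
  by (simp add: sofic_pressure_def sofic_entropy_def pressure_sum_zero)

lemma pressure_add_const: "P (\<lambda>x. f x + c) = P f + ereal c"
proof (rule antisym)
  show "P (\<lambda>x. f x + c) \<le> P f + ereal c"
    by (rule pressure_mono_const) simp
  have "P f \<le> P (\<lambda>x. f x + c) + ereal (- c)"
    by (rule pressure_mono_const) simp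
  then show "P f + ereal c \<le> P (\<lambda>x. f x + c)"
    by (cases "P f"; cases "P (\<lambda>x. f x + c)") auto
qed

lemma pressure_subadditive: "P (\<lambda>x. f x + g x) \<le> P f + P g"
  using pressure_linear_bound[of 1 1 f g] by (simp flip: one_ereal_def)

lemma pressure_convex:
  assumes "t \<in> {0..1}"
  shows "P (\<lambda>x. (1 - t) * u x + t * v x) \<le> ereal (1 - t) * P u + ereal t * P v"
proof (cases "t = 0 \<or> t = 1")
  case True
  then show ?thesis by (auto simp flip: zero_ereal_def one_ereal_def)
next
  case False
  then show ?thesis using assms by (intro pressure_linear_bound) auto
qed

lemma pressure_scale_ge_1:
  assumes "1 \<le> c"
  shows "P (\<lambda>x. c * f x) \<le> ereal c * P f"
proof -
  have "P (\<lambda>x. c / 2 * f x + c / 2 * f x) \<le> ereal (c / 2) * P f + ereal (c / 2) * P f"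
    using assms by (intro pressure_linear_bound) auto
  also have "ereal (c / 2) * P f + ereal (c / 2) * P f = ereal c * P f"
    using assms by (cases "P f") auto
  finally show ?thesis by simp
qed

text \<open>
  The coboundary enters with a sign \<open>r\<close> so that the estimate can be used in both directions.
\<close>
lemma pressure_add_coboundary_le:
  assumes s: "s \<in> carrier G" and g: "continuous_map X euclideanreal g" and r: "\<bar>r\<bar> = 1"
  shows "P (\<lambda>x. f x + r * (g (\<alpha> s x) - g x)) \<le> P f"
proof (rule ereal_le_epsilon2)
  fix e :: real assume e: "0 < e"
  obtain C where C: "0 \<le> C"
    "\<And>x y. x \<in> topspace X \<Longrightarrow> y \<in> topspace X \<Longrightarrow> \<bar>g x - g y\<bar> \<le> e / 2 + C * (\<rho> x y)\<^sup>2"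
    using quadratic_modulus_of_continuity[OF compact metric g, of "e / 2"] e by auto
  \<comment> \<open>chosen so that \<open>e / 2 + C * \<delta>\<^sup>2 \<le> e\<close>\<close>
  define \<delta> where "\<delta> = sqrt (e / (2 * (C + 1)))"
  have \<delta>: "0 < \<delta>" using e C by (simp add: \<delta>_def)
  have "\<delta>\<^sup>2 = e / (2 * (C + 1))" unfolding \<delta>_def using e C by (intro real_sqrt_pow2) auto
  then have "e / 2 + C * \<delta>\<^sup>2 = e - \<delta>\<^sup>2"
    using e C(1) by (simp add: field_simps)
  then have small: "e / 2 + C * \<delta>\<^sup>2 \<le> e"
    by simp
  show "P (\<lambda>x. f x + r * (g (\<alpha> s x) - g x)) \<le> P f + ereal e"
  proof (rule pressure_comparison[of "{s}" \<delta>])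
    fix i \<phi> assume di: "0 < d i" and \<phi>: "\<phi> \<in> sofic_Map X \<alpha> \<rho> {s} \<delta> (d i) (\<sigma> i)"
    have perm: "\<sigma> i s permutes {1..d i}"
      using approximation s by (simp add: sofic_approximation_def)
    have "\<bar>birkhoff (\<lambda>x. g (\<alpha> s x) - g x) (d i) \<phi>\<bar> \<le> (e / 2 + C * \<delta>\<^sup>2) * real (d i)"
      by (rule birkhoff_coboundary_bound[where s = s, OF \<phi> di perm action_in_topspace[OF s] C])
    also have "\<dots> \<le> e * real (d i)"
      using small by (rule mult_right_mono) simp
    finally have "\<bar>r * birkhoff (\<lambda>x. g (\<alpha> s x) - g x) (d i) \<phi>\<bar> \<le> e * real (d i)"
      using r by (simp add: abs_mult)
    moreover have "birkhoff (\<lambda>x. f x + r * (g (\<alpha> s x) - g x)) (d i) \<phi>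
        = birkhoff f (d i) \<phi> + r * birkhoff (\<lambda>x. g (\<alpha> s x) - g x) (d i) \<phi>"
      by (simp add: birkhoff_def sum.distrib sum_distrib_left)
    ultimately show "birkhoff (\<lambda>x. f x + r * (g (\<alpha> s x) - g x)) (d i) \<phi>
        \<le> birkhoff f (d i) \<phi> + e * real (d i)"
      by linarith
  qed (use s \<delta> in auto)
qed

lemma pressure_add_coboundary:
  assumes s: "s \<in> carrier G" and g: "continuous_map X euclideanreal g"
  shows "P (\<lambda>x. f x + g (\<alpha> s x) - g x) = P f"
proof (rule antisym)
  show "P (\<lambda>x. f x + g (\<alpha> s x) - g x) \<le> P f"
    using pressure_add_coboundary_le[OF s g, of 1 f] by (simp add: algebra_simps)
  show "P f \<le> P (\<lambda>x. f x + g (\<alpha> s x) - g x)"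
    using pressure_add_coboundary_le[OF s g, of "- 1" "\<lambda>x. f x + g (\<alpha> s x) - g x"]
    by (simp add: algebra_simps)
qed

section \<open>Finiteness and its consequences\<close>

lemma entropy_add_le_pressure:
  assumes "\<And>x. x \<in> topspace X \<Longrightarrow> m \<le> u x"
  shows "h + ereal m \<le> P u"
  using pressure_add_const[of "\<lambda>x. 0" m] pressure_mono[of "\<lambda>x. m" u] assms
  by (simp add: pressure_zero_eq_entropy)

lemma pressure_le_entropy_add:
  assumes "\<And>x. x \<in> topspace X \<Longrightarrow> u x \<le> m"
  shows "P u \<le> h + ereal m"
  using pressure_mono_const[of u "\<lambda>x. 0" m] assms by (simp add: pressure_zero_eq_entropy)

lemma pressure_infinite_iff:
  assumes "continuous_map X euclideanreal u"
  shows "P u = \<infinity> \<longleftrightarrow> h = \<infinity>" "P u = -\<infinity> \<longleftrightarrow> h = -\<infinity>"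
proof -
  obtain B where B: "\<And>x. x \<in> topspace X \<Longrightarrow> \<bar>u x\<bar> \<le> B"
    using bounded_continuous_map_image[OF compact assms] by (auto simp: bounded_iff)
  have "h + ereal (- B) \<le> P u" "P u \<le> h + ereal B"
    using B by (auto intro!: entropy_add_le_pressure pressure_le_entropy_add simp: abs_le_iff minus_le_iff)
  then show "P u = \<infinity> \<longleftrightarrow> h = \<infinity>" "P u = -\<infinity> \<longleftrightarrow> h = -\<infinity>"
    by (cases h; cases "P u"; simp)+
qed

lemma constantly_on_C_pressure:
  "constantly_on_C X P \<infinity> \<longleftrightarrow> h = \<infinity>" "constantly_on_C X P (-\<infinity>) \<longleftrightarrow> h = -\<infinity>"
proof -
  have "continuous_map X euclideanreal (\<lambda>x. 0)" by simp
  then show "constantly_on_C X P \<infinity> \<longleftrightarrow> h = \<infinity>" "constantly_on_C X P (-\<infinity>) \<longleftrightarrow> h = -\<infinity>"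
    using pressure_infinite_iff unfolding constantly_on_C_def by blast+
qed

lemma pressure_finite:
  assumes "\<bar>h\<bar> \<noteq> \<infinity>" "continuous_map X euclideanreal u"
  obtains p where "P u = ereal p"
  using pressure_infinite_iff[OF assms(2)] assms(1) by (cases "P u") auto

lemma entropy_nonneg:
  assumes "h \<noteq> -\<infinity>"
  shows "0 \<le> h"
  using pressure_subadditive[of "\<lambda>x. 0" "\<lambda>x. 0"] assms
  by (cases h) (auto simp: pressure_zero_eq_entropy)

lemma pressure_lipschitz:
  assumes h: "\<bar>h\<bar> \<noteq> \<infinity>"
    and f: "continuous_map X euclideanreal f" and g: "continuous_map X euclideanreal g"
  shows "\<bar>P f - P g\<bar> \<le> ereal (SUP x\<in>topspace X. \<bar>f x - g x\<bar>)"
proof -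
  let ?N = "SUP x\<in>topspace X. \<bar>f x - g x\<bar>"
  have "continuous_map X euclideanreal (\<lambda>x. \<bar>f x - g x\<bar>)"
    using f g by (intro continuous_map_real_abs continuous_map_diff)
  then have "bdd_above ((\<lambda>x. \<bar>f x - g x\<bar>) ` topspace X)"
    by (intro bounded_imp_bdd_above bounded_continuous_map_image[OF compact])
  then have N: "\<bar>f x - g x\<bar> \<le> ?N" if "x \<in> topspace X" for x
    using that by (intro cSUP_upper)
  have "P f \<le> P g + ereal ?N" "P g \<le> P f + ereal ?N"
    using N by (intro pressure_mono_const; force simp: abs_le_iff)+
  moreover obtain p where "P f = ereal p" using pressure_finite[OF h f] .
  moreover obtain q where "P g = ereal q" using pressure_finite[OF h g] .
  ultimately show ?thesis by auto
qed

text \<open>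
  For \<open>0 < c\<close> this is the inequality for \<open>1 / c \<ge> 1\<close> applied to \<open>c f\<close>. For \<open>c \<le> 0\<close> the zero function
  is the convex combination of \<open>c f\<close> and \<open>f\<close> with weights \<open>1 / (1 - c)\<close> and \<open>- c / (1 - c)\<close>, and its
  pressure is nonnegative.
\<close>
lemma pressure_scale_le_1:
  assumes f: "continuous_map X euclideanreal f" and c: "c \<le> 1" and nontrivial: "0 < c \<or> h \<noteq> -\<infinity>"
  shows "ereal c * P f \<le> P (\<lambda>x. c * f x)"
proof (cases "0 < c")
  case True
  have "P (\<lambda>x. 1 / c * (c * f x)) \<le> ereal (1 / c) * P (\<lambda>x. c * f x)"
    using True c by (intro pressure_scale_ge_1) simp
  then have "P f \<le> ereal (1 / c) * P (\<lambda>x. c * f x)"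
    using True by simp
  then have "ereal c * P f \<le> ereal c * (ereal (1 / c) * P (\<lambda>x. c * f x))"
    using True by (intro ereal_mult_left_mono) auto
  also have "\<dots> = P (\<lambda>x. c * f x)"
    using True by (cases "P (\<lambda>x. c * f x)") auto
  finally show ?thesis .
next
  case False
  have cf: "continuous_map X euclideanreal (\<lambda>x. c * f x)"
    using f by (intro continuous_map_real_mult_left)
  have "h \<noteq> -\<infinity>" using False nontrivial by simp
  show ?thesis
  proof (cases "h = \<infinity>")
    case True
    then show ?thesis using pressure_infinite_iff(1)[OF cf] by simp
  next
    case fin: False
    then have h: "\<bar>h\<bar> \<noteq> \<infinity>" using \<open>h \<noteq> -\<infinity>\<close> by (cases h) auto
    obtain p where p: "P f = ereal p" using pressure_finite[OF h f] .
    obtain q where q: "P (\<lambda>x. c * f x) = ereal q" using pressure_finite[OF h cf] .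
    define t where "t = - c / (1 - c)"
    have t: "t \<in> {0..1}" "1 - t = 1 / (1 - c)"
      using False by (auto simp: t_def field_simps)
    have "(\<lambda>x. (1 - t) * (c * f x) + t * f x) = (\<lambda>x. 0)"
      unfolding t(2) using False by (auto simp: t_def field_simps)
    then have "0 \<le> ereal (1 - t) * P (\<lambda>x. c * f x) + ereal t * P f"
      using pressure_convex[OF t(1), of "\<lambda>x. c * f x" f] entropy_nonneg[OF \<open>h \<noteq> -\<infinity>\<close>]
      by (simp add: pressure_zero_eq_entropy)
    then have "0 \<le> (1 - t) * q + t * p"
      by (simp add: p q)
    also have "\<dots> = (q - c * p) / (1 - c)"
      unfolding t(2) using False by (simp add: t_def diff_divide_distrib)
    finally have "c * p \<le> q"
      using False by (simp add: zero_le_divide_iff)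
    then show ?thesis by (simp add: p q)
  qed
qed

text \<open>The lower bound combines \<open>0 \<le> P 0 \<le> P f + P (- f)\<close> with \<open>P (- f) \<le> P \<bar>f\<bar>\<close>.\<close>
lemma abs_pressure_le:
  assumes f: "continuous_map X euclideanreal f" and h: "h \<noteq> -\<infinity>"
  shows "\<bar>P f\<bar> \<le> P (\<lambda>x. \<bar>f x\<bar>)"
proof -
  have up: "P f \<le> P (\<lambda>x. \<bar>f x\<bar>)" and neg: "P (\<lambda>x. - f x) \<le> P (\<lambda>x. \<bar>f x\<bar>)"
    by (intro pressure_mono; simp)+
  have "0 \<le> P f + P (\<lambda>x. - f x)"
    using pressure_subadditive[of f "\<lambda>x. - f x"] entropy_nonneg[OF h]
    by (simp add: pressure_zero_eq_entropy)
  also have "\<dots> \<le> P f + P (\<lambda>x. \<bar>f x\<bar>)"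
    using neg by (rule add_left_mono)
  finally have low: "0 \<le> P f + P (\<lambda>x. \<bar>f x\<bar>)" .
  have "P f \<noteq> -\<infinity>"
    using h by (simp add: pressure_infinite_iff(2)[OF f])
  with up low show ?thesis
    by (cases "P f"; cases "P (\<lambda>x. \<bar>f x\<bar>)") auto
qed

end

theorem proposition6p1:
  fixes G :: "('g, 'r) monoid_scheme"
    and X :: "'x topology"
    and \<alpha> :: "'g \<Rightarrow> 'x \<Rightarrow> 'x"
    and \<rho> :: "'x \<Rightarrow> 'x \<Rightarrow> real"
    and d :: "nat \<Rightarrow> nat"
    and \<sigma> :: "nat \<Rightarrow> 'g \<Rightarrow> nat \<Rightarrow> nat"
    and f g :: "'x \<Rightarrow> real"
    and s :: 'g
    and c :: real
  defines "P \<equiv> sofic_pressure G X \<alpha> \<rho> d \<sigma>"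
    and "h \<equiv> sofic_entropy G X \<alpha> \<rho> d \<sigma>"
  assumes "sofic_group G"
    and "compact_space X" and "metrizable_space X" and "compatible_metric X \<rho>"
    and "continuous_group_action G X \<alpha>"
    and "sofic_approximation G d \<sigma>"
    and "continuous_map X euclideanreal f"
    and "continuous_map X euclideanreal g"
    and "s \<in> carrier G"
  shows
    "P (\<lambda>x. 0) = h \<and>
     P (\<lambda>x. f x + c) = P f + ereal c \<and>
     P (\<lambda>x. f x + g x) \<le> P f + P g \<and>
     ((\<forall>x\<in>topspace X. f x \<le> g x) \<longrightarrow> P f \<le> P g) \<and>
     h + ereal (INF x\<in>topspace X. f x) \<le> P f \<and>
     P f \<le> h + ereal (SUP x\<in>topspace X. f x) \<and>
     ((\<forall>u. continuous_map X euclideanreal u \<longrightarrow> \<bar>P u\<bar> \<noteq> \<infinity>) \<or>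
       constantly_on_C X P \<infinity> \<or> constantly_on_C X P (-\<infinity>)) \<and>
     (\<not> constantly_on_C X P \<infinity> \<and> \<not> constantly_on_C X P (-\<infinity>) \<longrightarrow>
       \<bar>P f - P g\<bar> \<le> ereal (SUP x\<in>topspace X. \<bar>f x - g x\<bar>)) \<and>
     (\<not> constantly_on_C X P \<infinity> \<and> \<not> constantly_on_C X P (-\<infinity>) \<longrightarrow>
       (\<forall>u v. \<forall>t\<in>{0..1}.
          continuous_map X euclideanreal u \<and> continuous_map X euclideanreal v \<longrightarrow>
          P (\<lambda>x. (1 - t) * u x + t * v x) \<le> ereal (1 - t) * P u + ereal t * P v)) \<and>
     P (\<lambda>x. f x + g (\<alpha> s x) - g x) = P f \<and>
     (c \<ge> 1 \<longrightarrow> P (\<lambda>x. c * f x) \<le> ereal c * P f) \<and>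
     (c \<le> 1 \<and> (c > 0 \<or> \<not> constantly_on_C X P (-\<infinity>)) \<longrightarrow>
       P (\<lambda>x. c * f x) \<ge> ereal c * P f) \<and>
     (\<not> constantly_on_C X P (-\<infinity>) \<longrightarrow> \<bar>P f\<bar> \<le> P (\<lambda>x. \<bar>f x\<bar>))"
proof -
  interpret sofic_system G X \<alpha> \<rho> d \<sigma>
    using assms(4,6-8) by unfold_locales
  note f = assms(9) and g = assms(10) and s = assms(11)
  have fin: "\<bar>x\<bar> \<noteq> \<infinity>" if "x \<noteq> \<infinity>" "x \<noteq> -\<infinity>" for x :: ereal
    using that by (cases x) auto
  have bdd: "bdd_below (f ` topspace X)" "bdd_above (f ` topspace X)"
    using bounded_continuous_map_image[OF compact f]
    by (simp_all add: bounded_imp_bdd_below bounded_imp_bdd_above)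
  have const: "constantly_on_C X P \<infinity> \<longleftrightarrow> h = \<infinity>" "constantly_on_C X P (-\<infinity>) \<longleftrightarrow> h = -\<infinity>"
    unfolding P_def h_def by (rule constantly_on_C_pressure)+
  have finite_P: "\<bar>P u\<bar> \<noteq> \<infinity>"
    if "h \<noteq> \<infinity>" "h \<noteq> -\<infinity>" "continuous_map X euclideanreal u" for u
    using pressure_infinite_iff[OF that(3)] that(1,2) fin unfolding P_def h_def by blast
  have lipschitz: "\<bar>P f - P g\<bar> \<le> ereal (SUP x\<in>topspace X. \<bar>f x - g x\<bar>)" if "h \<noteq> \<infinity>" "h \<noteq> -\<infinity>"
    unfolding P_def using fin[OF that, unfolded h_def] f g by (rule pressure_lipschitz)
  have scale: "ereal c * P f \<le> P (\<lambda>x. c * f x)" if "c \<le> 1" "0 < c \<or> h \<noteq> -\<infinity>"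
    unfolding P_def using f that(1) that(2)[unfolded h_def] by (rule pressure_scale_le_1)
  have abs_le: "\<bar>P f\<bar> \<le> P (\<lambda>x. \<bar>f x\<bar>)" if "h \<noteq> -\<infinity>"
    unfolding P_def using f that[unfolded h_def] by (rule abs_pressure_le)
  show ?thesis
    unfolding const
  proof (intro conjI impI)
    show "P (\<lambda>x. 0) = h"
      unfolding P_def h_def by (rule pressure_zero_eq_entropy)
    show "P (\<lambda>x. f x + c) = P f + ereal c"
      unfolding P_def by (rule pressure_add_const)
    show "P (\<lambda>x. f x + g x) \<le> P f + P g"
      unfolding P_def by (rule pressure_subadditive)
    show "P f \<le> P g" if "\<forall>x\<in>topspace X. f x \<le> g x"
      unfolding P_def using that by (intro pressure_mono) blast
    show "h + ereal (INF x\<in>topspace X. f x) \<le> P f"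
      unfolding P_def h_def using bdd by (intro entropy_add_le_pressure cINF_lower)
    show "P f \<le> h + ereal (SUP x\<in>topspace X. f x)"
      unfolding P_def h_def using bdd by (intro pressure_le_entropy_add cSUP_upper)
    show "(\<forall>u. continuous_map X euclideanreal u \<longrightarrow> \<bar>P u\<bar> \<noteq> \<infinity>) \<or> h = \<infinity> \<or> h = -\<infinity>"
    proof (cases "h = \<infinity> \<or> h = -\<infinity>")
      case False
      then have "\<forall>u. continuous_map X euclideanreal u \<longrightarrow> \<bar>P u\<bar> \<noteq> \<infinity>"
        using finite_P by (intro allI impI) simp_all
      then show ?thesis ..
    qed (rule disjI2)
    show "\<bar>P f - P g\<bar> \<le> ereal (SUP x\<in>topspace X. \<bar>f x - g x\<bar>)" if "h \<noteq> \<infinity> \<and> h \<noteq> -\<infinity>"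
      using that by (intro lipschitz) simp_all
    show "\<forall>u v. \<forall>t\<in>{0..1}. continuous_map X euclideanreal u \<and> continuous_map X euclideanreal v \<longrightarrow>
        P (\<lambda>x. (1 - t) * u x + t * v x) \<le> ereal (1 - t) * P u + ereal t * P v"
      unfolding P_def by (intro allI ballI impI pressure_convex)
    show "P (\<lambda>x. f x + g (\<alpha> s x) - g x) = P f"
      unfolding P_def using s g by (rule pressure_add_coboundary)
    show "P (\<lambda>x. c * f x) \<le> ereal c * P f" if "1 \<le> c"
      unfolding P_def using that by (rule pressure_scale_ge_1)
    show "ereal c * P f \<le> P (\<lambda>x. c * f x)" if "c \<le> 1 \<and> (0 < c \<or> h \<noteq> -\<infinity>)"
      using that by (intro scale) simp_all
    show "\<bar>P f\<bar> \<le> P (\<lambda>x. \<bar>f x\<bar>)" if "h \<noteq> -\<infinity>"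
      using that by (rule abs_le)
  qed
qed

end
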